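(* Let $(E,r)$ be a $q$-matroid and let $\mathcal{Z}$ be a collection of subspaces of $E$. There exists a $q$-matroid on $E$ whose collection of cyclic flats is exactly $\mathcal{Z}$ and whose rank function agrees with $r$ on every element of $\mathcal{Z}$ if and only if $\mathcal{Z}$ is a lattice under inclusion such that the following hold, where $\vee,\wedge$ denote the join and meet of the lattice $\mathcal{Z}$ and $0_{\mathcal{Z}}$ its least element: (Z1) $r(0_{\mathcal{Z}})=0$; (Z2) for all $F,G\in\mathcal{Z}$ with $G<F$: $0<r(F)-r(G)<\dim F-\dim G$; (Z3) for all $F,G\in\mathcal{Z}$: $r(F)+r(G)\ge r(F\vee G)+r(F\wedge G)+\dim\big((F\cap G)/(F\wedge G)\big)$.
   Context: Let $q$ be a prime power and $E$ an $n$-dimensional vector space over $\mathbb{F}_q$; $\mathcal{L}(E)$ denotes the lattice of subspaces of $E$. A $q$-matroid $(E,r)$ is given by a function $r:\mathcal{L}(E)\to\mathbb{Z}$ (the rank function) such that (R1) $0\le r(A)\le \dim A$ for all $A$; (R2) $r(A)\le r(B)$ whenever $A\le B$; (R3) $r(A+B)+r(A\cap B)\le r(A)+r(B)$ for all $A,B$. A subspace $A$ is a flat if $r(A+x)>r(A)$ for every $1$-dimensional subspace $x\le E$ with $x\not\le A$. A subspace $A$ is cyclic if $r(B)=r(A)$ for every subspace $B\le A$ of codimension $1$ in $A$. A cyclic flat is a subspace that is both cyclic and a flat. (For a lattice of subspaces ordered by inclusion, $F\wedge G\le F\cap G$, so the quotient in (Z3) makes sense.) *)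

theory Defs
  imports
    "HOL-Algebra.Lattice"
    "HOL-Library.Set_Algebras"
    "HOL.Vector_Spaces"
begin

text \<open>
  The ground space \<open>E\<close> is the whole type carrying the vector space structure. A rank function is a
  total function on sets of vectors; only its values on subspaces are ever used. The sum of two
  subspaces is the elementwise sum of sets from \<open>Set_Algebras\<close>.
\<close>

context vector_space
begin

definition q_matroid :: "('b set \<Rightarrow> int) \<Rightarrow> bool" where
  "q_matroid r \<longleftrightarrow>
    (\<forall>A. subspace A \<longrightarrow> 0 \<le> r A \<and> r A \<le> int (dim A)) \<and>
    (\<forall>A B. subspace A \<longrightarrow> subspace B \<longrightarrow> A \<subseteq> B \<longrightarrow> r A \<le> r B) \<and>
    (\<forall>A B. subspace A \<longrightarrow> subspace B \<longrightarrow> r (A + B) + r (A \<inter> B) \<le> r A + r B)"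

definition flat :: "('b set \<Rightarrow> int) \<Rightarrow> 'b set \<Rightarrow> bool" where
  "flat r A \<longleftrightarrow> subspace A \<and>
    (\<forall>x. subspace x \<longrightarrow> dim x = 1 \<longrightarrow> \<not> x \<subseteq> A \<longrightarrow> r A < r (A + x))"

definition cyclic :: "('b set \<Rightarrow> int) \<Rightarrow> 'b set \<Rightarrow> bool" where
  "cyclic r A \<longleftrightarrow> subspace A \<and>
    (\<forall>B. subspace B \<longrightarrow> B \<subseteq> A \<longrightarrow> dim A = dim B + 1 \<longrightarrow> r B = r A)"

definition cyclic_flat :: "('b set \<Rightarrow> int) \<Rightarrow> 'b set \<Rightarrow> bool" where
  "cyclic_flat r A \<longleftrightarrow> cyclic r A \<and> flat r A"

text \<open>
  For subspaces \<open>C \<subseteq> A\<close>, \<open>quotient_basis A C S\<close> says that the cosets \<open>s + C\<close> with \<open>s \<in> S\<close> are pairwise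
  distinct and form a basis of the quotient space \<open>A / C\<close>.
\<close>

definition quotient_basis :: "'b set \<Rightarrow> 'b set \<Rightarrow> 'b set \<Rightarrow> bool" where
  "quotient_basis A C S \<longleftrightarrow> S \<subseteq> A \<and> A \<subseteq> span S + C \<and>
    (\<forall>T u. finite T \<longrightarrow> T \<subseteq> S \<longrightarrow> (\<Sum>v\<in>T. scale (u v) v) \<in> C \<longrightarrow> (\<forall>v\<in>T. u v = 0))"

definition quotient_dim :: "'b set \<Rightarrow> 'b set \<Rightarrow> nat" where
  "quotient_dim A C = card (SOME S. quotient_basis A C S)"

end

lemma (in finite_dimensional_vector_space) quotient_basis_card:
  assumes A: "subspace A" and C: "subspace C" "C \<subseteq> A" and S: "quotient_basis A C S"
  shows "card S + dim C = dim A"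
proof -
  have SA: "S \<subseteq> A" and gen: "A \<subseteq> span S + C"
    and ind: "\<And>T u v. finite T \<Longrightarrow> T \<subseteq> S \<Longrightarrow> (\<Sum>v\<in>T. scale (u v) v) \<in> C \<Longrightarrow> v \<in> T \<Longrightarrow> u v = 0"
    using S unfolding quotient_basis_def by blast+
  obtain T where T: "T \<subseteq> C" "independent T" "C \<subseteq> span T" "card T = dim C"
    using basis_exists[of C] by blast
  have spT: "span T = C" using T C by (metis span_subspace)
  have finT: "finite T" using T finiteI_independent by blast
  have disj: "S \<inter> T = {}"
  proof (rule ccontr)
    assume "S \<inter> T \<noteq> {}"
    then obtain s where "s \<in> S" "s \<in> C" using T by blast
    then show False using ind[of "{s}" "\<lambda>_. 1" s] by simp
  qed
  have indS: "independent S"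
    unfolding dependent_explicit using ind C(1) subspace_0 by metis
  then have finS: "finite S" using finiteI_independent by blast
  have indST: "independent (S \<union> T)"
  proof (rule independent_if_scalars_zero)
    show "finite (S \<union> T)" using finS finT by simp
    fix f x assume *: "(\<Sum>x\<in>S \<union> T. scale (f x) x) = 0" and x: "x \<in> S \<union> T"
    have sum: "(\<Sum>x\<in>S. scale (f x) x) + (\<Sum>x\<in>T. scale (f x) x) = 0"
      using * disj finS finT by (simp add: sum.union_disjoint)
    have TC: "(\<Sum>x\<in>T. scale (f x) x) \<in> C"
      using T(1) C(1) by (intro subspace_sum subspace_scale) auto
    have "(\<Sum>x\<in>S. scale (f x) x) = - (\<Sum>x\<in>T. scale (f x) x)"
      using sum by (simp add: eq_neg_iff_add_eq_0)
    then have "(\<Sum>x\<in>S. scale (f x) x) \<in> C" using subspace_neg[OF C(1) TC] by simp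
    then have S0: "\<forall>x\<in>S. f x = 0" using ind finS by blast
    then have "(\<Sum>x\<in>T. scale (f x) x) = 0" using sum by simp
    then have "\<forall>x\<in>T. f x = 0" using T(2) finT independentD by blast
    then show "f x = 0" using S0 x by blast
  qed
  have "span (S \<union> T) = span S + C"
    unfolding span_Un spT by (auto simp: set_plus_def)
  then have "A \<subseteq> span (S \<union> T)" using gen by simp
  then have "card (S \<union> T) = dim A"
    using basis_card_eq_dim[of "S \<union> T" A] SA T(1) C(2) indST by blast
  then show ?thesis using disj finS finT T(4) by (simp add: card_Un_disjoint)
qed

lemma (in finite_dimensional_vector_space) quotient_basis_exists:
  assumes A: "subspace A" and C: "subspace C" "C \<subseteq> A"
  shows "\<exists>S. quotient_basis A C S"
proof -
  obtain T where T: "T \<subseteq> C" "independent T" "C \<subseteq> span T" "card T = dim C"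
    using basis_exists[of C] by blast
  have spT: "span T = C" using T C by (metis span_subspace)
  obtain B where B: "T \<subseteq> B" "B \<subseteq> A" "independent B" "A \<subseteq> span B"
    using maximal_independent_subset_extend[OF subset_trans[OF T(1) C(2)] T(2)] by metis
  have finB: "finite B" using B finiteI_independent by blast
  have "span B = span ((B - T) \<union> T)" using B(1) by (simp add: Un_absorb2)
  also have "\<dots> = span (B - T) + C"
    unfolding span_Un spT by (auto simp: set_plus_def)
  finally have gen: "A \<subseteq> span (B - T) + C" using B by simp
  have "u v = 0" if U: "finite U" "U \<subseteq> B - T" "(\<Sum>v\<in>U. scale (u v) v) \<in> C" "v \<in> U" for U u v
  proof -
    have finT: "finite T" using finB B(1) finite_subset by blast
    obtain w where w: "(\<Sum>v\<in>U. scale (u v) v) = (\<Sum>v\<in>T. scale (w v) v)"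
      using U(3) span_finite[OF finT] spT by auto
    define f where "f v = (if v \<in> T then - w v else u v)" for v
    have "(\<Sum>v\<in>U \<union> T. scale (f v) v) = (\<Sum>v\<in>U. scale (f v) v) + (\<Sum>v\<in>T. scale (f v) v)"
      using U finT by (intro sum.union_disjoint) auto
    also have "(\<Sum>v\<in>U. scale (f v) v) = (\<Sum>v\<in>U. scale (u v) v)"
      using U(2) by (intro sum.cong) (auto simp: f_def)
    also have "(\<Sum>v\<in>T. scale (f v) v) = - (\<Sum>v\<in>T. scale (w v) v)"
      by (simp add: f_def sum_negf)
    finally have "(\<Sum>v\<in>U \<union> T. scale (f v) v) = 0" using w by simp
    moreover have "U \<union> T \<subseteq> B" using U B by blast
    ultimately have "f v = 0" using B(3) U finT independentD[of B "U \<union> T" f v] by blast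
    then show ?thesis using U by (auto simp: f_def)
  qed
  then have "quotient_basis A C (B - T)"
    unfolding quotient_basis_def using gen B(2) by blast
  then show ?thesis ..
qed

lemma (in finite_dimensional_vector_space) quotient_dim_eq:
  assumes "subspace A" and "subspace C" "C \<subseteq> A"
  shows "quotient_dim A C + dim C = dim A"
  unfolding quotient_dim_def
  using quotient_basis_card[OF assms someI_ex[OF quotient_basis_exists[OF assms]]] .

abbreviation incl_order :: "'b set set \<Rightarrow> 'b set gorder" where
  "incl_order Z \<equiv> \<lparr>carrier = Z, eq = (=), le = (\<subseteq>)\<rparr>"

end

theory Submission
  imports Defs
begin

text \<open>
  Write \<open>n A = dim A - r A\<close>. The closure of \<open>A\<close> is the largest subspace of rank \<open>r A\<close> containing \<open>A\<close>,
  and, since \<open>n\<close> is supermodular, every \<open>A\<close> has a least subspace of the same nullity, its cyclic core.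
  For cyclic flats \<open>F\<close>, \<open>G\<close> the join is the closure of \<open>F + G\<close> and the meet is the cyclic core of
  \<open>F \<inter> G\<close>; passing to the core lowers rank and dimension by the same amount, so (Z3) is submodularity.

  Conversely, the rank function with cyclic flats \<open>Z\<close> is \<open>A \<mapsto> min\<^sub>F\<^sub>\<in>\<^sub>Z (r F + dim A - dim (A \<inter> F))\<close>.
\<close>

section \<open>Joins, meets and least elements of a family of sets ordered by inclusion\<close>

lemma least_Upper_incl_order:
  assumes "F \<in> Z" "G \<in> Z"
  shows "least (incl_order Z) J (Upper (incl_order Z) {F, G}) \<longleftrightarrow>
    J \<in> Z \<and> F \<subseteq> J \<and> G \<subseteq> J \<and> (\<forall>K\<in>Z. F \<subseteq> K \<longrightarrow> G \<subseteq> K \<longrightarrow> J \<subseteq> K)"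
proof -
  have "Upper (incl_order Z) {F, G} = {K \<in> Z. F \<subseteq> K \<and> G \<subseteq> K}"
    using assms by (auto simp: Upper_def)
  then show ?thesis unfolding least_def by auto
qed

lemma greatest_Lower_incl_order:
  assumes "F \<in> Z" "G \<in> Z"
  shows "greatest (incl_order Z) M (Lower (incl_order Z) {F, G}) \<longleftrightarrow>
    M \<in> Z \<and> M \<subseteq> F \<and> M \<subseteq> G \<and> (\<forall>K\<in>Z. K \<subseteq> F \<longrightarrow> K \<subseteq> G \<longrightarrow> K \<subseteq> M)"
proof -
  have "Lower (incl_order Z) {F, G} = {K \<in> Z. K \<subseteq> F \<and> K \<subseteq> G}"
    using assms by (auto simp: Lower_def)
  then show ?thesis unfolding greatest_def by auto
qed

lemma lattice_incl_orderI:
  assumes "\<And>F G. F \<in> Z \<Longrightarrow> G \<in> Z \<Longrightarrow> \<exists>J\<in>Z. F \<subseteq> J \<and> G \<subseteq> J \<and> (\<forall>K\<in>Z. F \<subseteq> K \<longrightarrow> G \<subseteq> K \<longrightarrow> J \<subseteq> K)"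
    and "\<And>F G. F \<in> Z \<Longrightarrow> G \<in> Z \<Longrightarrow> \<exists>M\<in>Z. M \<subseteq> F \<and> M \<subseteq> G \<and> (\<forall>K\<in>Z. K \<subseteq> F \<longrightarrow> K \<subseteq> G \<longrightarrow> K \<subseteq> M)"
  shows "lattice (incl_order Z)"
proof unfold_locales
  fix F G assume "F \<in> carrier (incl_order Z)" "G \<in> carrier (incl_order Z)"
  then have FG: "F \<in> Z" "G \<in> Z" by simp_all
  show "\<exists>s. least (incl_order Z) s (Upper (incl_order Z) {F, G})"
    unfolding least_Upper_incl_order[OF FG] using assms(1)[OF FG] by blast
  show "\<exists>s. greatest (incl_order Z) s (Lower (incl_order Z) {F, G})"
    unfolding greatest_Lower_incl_order[OF FG] using assms(2)[OF FG] by blast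
qed auto

text \<open>The join of \<open>incl_order Z\<close> is picked by choice among the least upper
  bounds; antisymmetry leaves \<open>J\<close> as the only candidate. The next two lemmas do the
  same for meet and bottom.\<close>

lemma join_incl_order_eq:
  assumes "F \<in> Z" "G \<in> Z" "J \<in> Z" "F \<subseteq> J" "G \<subseteq> J" "\<And>K. K \<in> Z \<Longrightarrow> F \<subseteq> K \<Longrightarrow> G \<subseteq> K \<Longrightarrow> J \<subseteq> K"
  shows "F \<squnion>\<^bsub>incl_order Z\<^esub> G = J"
proof -
  have "least (incl_order Z) x (Upper (incl_order Z) {F, G}) \<longleftrightarrow> x = J" for x
    unfolding least_Upper_incl_order[OF assms(1,2)] using assms(3-6) subset_antisym[of x J] by metis
  then show ?thesis unfolding join_def sup_def by simp
qed

lemma meet_incl_order_eq: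
  assumes "F \<in> Z" "G \<in> Z" "M \<in> Z" "M \<subseteq> F" "M \<subseteq> G" "\<And>K. K \<in> Z \<Longrightarrow> K \<subseteq> F \<Longrightarrow> K \<subseteq> G \<Longrightarrow> K \<subseteq> M"
  shows "F \<sqinter>\<^bsub>incl_order Z\<^esub> G = M"
proof -
  have "greatest (incl_order Z) x (Lower (incl_order Z) {F, G}) \<longleftrightarrow> x = M" for x
    unfolding greatest_Lower_incl_order[OF assms(1,2)] using assms(3-6) subset_antisym[of x M] by metis
  then show ?thesis unfolding meet_def inf_def by simp
qed

lemma bottom_incl_order_eq:
  assumes "M \<in> Z" "\<And>K. K \<in> Z \<Longrightarrow> M \<subseteq> K"
  shows "\<bottom>\<^bsub>incl_order Z\<^esub> = M"
proof -
  have "(x \<in> Z \<and> (\<forall>K\<in>Z. x \<subseteq> K)) \<longleftrightarrow> x = M" for x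
    using assms subset_antisym[of x M] by metis
  then show ?thesis unfolding bottom_def least_def by simp
qed

lemma lattice_incl_orderD:
  assumes "lattice (incl_order Z)" "F \<in> Z" "G \<in> Z"
  shows "F \<squnion>\<^bsub>incl_order Z\<^esub> G \<in> Z" "F \<subseteq> F \<squnion>\<^bsub>incl_order Z\<^esub> G" "G \<subseteq> F \<squnion>\<^bsub>incl_order Z\<^esub> G"
    and "F \<sqinter>\<^bsub>incl_order Z\<^esub> G \<in> Z" "F \<sqinter>\<^bsub>incl_order Z\<^esub> G \<subseteq> F" "F \<sqinter>\<^bsub>incl_order Z\<^esub> G \<subseteq> G"
proof -
  interpret lattice "incl_order Z" by fact
  show "F \<squnion>\<^bsub>incl_order Z\<^esub> G \<in> Z" "F \<subseteq> F \<squnion>\<^bsub>incl_order Z\<^esub> G" "G \<subseteq> F \<squnion>\<^bsub>incl_order Z\<^esub> G"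
    "F \<sqinter>\<^bsub>incl_order Z\<^esub> G \<in> Z" "F \<sqinter>\<^bsub>incl_order Z\<^esub> G \<subseteq> F" "F \<sqinter>\<^bsub>incl_order Z\<^esub> G \<subseteq> G"
    using join_closed[of F G] join_left[of F G] join_right[of F G]
      meet_closed[of F G] meet_left[of F G] meet_right[of F G] assms(2,3) by auto
qed

context finite_dimensional_vector_space
begin

section \<open>Sums, lines and hyperplanes of subspaces\<close>

lemma set_plus_eq_sums: "A + B = {x + y |x y. x \<in> A \<and> y \<in> B}"
  by (auto simp: set_plus_def)

lemma subspace_set_plus: "subspace A \<Longrightarrow> subspace B \<Longrightarrow> subspace (A + B)"
  using subspace_sums[of A B] unfolding set_plus_eq_sums .

lemma set_plus_superset:
  assumes "subspace A" "subspace B"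
  shows "A \<subseteq> A + B" "B \<subseteq> A + B"
  using set_plus_intro[of _ A 0 B] set_plus_intro[of 0 A _ B] subspace_0[OF assms(1)] subspace_0[OF assms(2)]
  by auto

lemma set_plus_least:
  assumes "subspace C" "A \<subseteq> C" "B \<subseteq> C"
  shows "A + B \<subseteq> C"
  using assms by (auto simp: set_plus_def subspace_add subset_iff)

lemma dim_set_plus_Int:
  assumes "subspace A" "subspace B"
  shows "int (dim (A + B)) + int (dim (A \<inter> B)) = int (dim A) + int (dim B)"
  using dim_sums_Int[OF assms] unfolding set_plus_eq_sums by simp

text \<open>Extremal dimension takes the place of induction: hyperplanes and closures are maximal
  for a suitable \<open>P\<close>, cyclic cores and the least element of \<open>Z\<close> are
  minimal.\<close>

lemma ex_max_dim:
  assumes "P A"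
  shows "\<exists>B. P B \<and> (\<forall>C. P C \<longrightarrow> dim C \<le> dim B)"
  using ex_has_greatest_nat[of P A dim "Suc dimension"] assms dim_subset_UNIV by (simp add: less_Suc_eq_le)

lemma ex_min_dim:
  assumes "P A"
  shows "\<exists>B. P B \<and> (\<forall>C. P C \<longrightarrow> dim B \<le> dim C)"
  using ex_has_least_nat[of P A dim] assms by blast

lemma subspace_less_dim: "subspace A \<Longrightarrow> subspace B \<Longrightarrow> A \<subset> B \<Longrightarrow> dim A < dim B"
  using subspace_dim_equal[of A B] by force

lemma ex_line:
  assumes "subspace A" "subspace B" "\<not> A \<subseteq> B"
  shows "\<exists>x. subspace x \<and> dim x = 1 \<and> x \<subseteq> A \<and> \<not> x \<subseteq> B"
proof -
  obtain v where v: "v \<in> A" "v \<notin> B" using assms by blast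
  then have "v \<noteq> 0" using subspace_0[OF assms(2)] by blast
  then have "dim (span {v}) = 1" by simp
  moreover have "span {v} \<subseteq> A" using v assms span_minimal[of "{v}" A] by simp
  moreover have "v \<in> span {v}" by (simp add: span_base)
  ultimately show ?thesis using v subspace_span by blast
qed

lemma dim_plus_line:
  assumes "subspace A" "subspace x" "dim x = 1" "\<not> x \<subseteq> A"
  shows "dim (A + x) = dim A + 1"
proof -
  have "dim (A \<inter> x) < dim x" using assms by (intro subspace_less_dim subspace_inter) auto
  then show ?thesis using dim_set_plus_Int[OF assms(1,2)] assms(3) by linarith
qed

lemma ex_hyperplane:
  assumes "subspace C" "subspace A" "C \<subset> A"
  shows "\<exists>H. subspace H \<and> C \<subseteq> H \<and> H \<subseteq> A \<and> dim A = dim H + 1"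
proof -
  let ?P = "\<lambda>H. subspace H \<and> C \<subseteq> H \<and> H \<subset> A"
  obtain H where H: "?P H" and max: "\<And>K. ?P K \<Longrightarrow> dim K \<le> dim H"
    using ex_max_dim[of ?P C] assms by blast
  then have "\<not> A \<subseteq> H" by blast
  then obtain x where x: "subspace x" "dim x = 1" "x \<subseteq> A" "\<not> x \<subseteq> H"
    using ex_line[of A H] assms H by blast
  have dim: "dim (H + x) = dim H + 1" using dim_plus_line x H by blast
  have "H + x \<subseteq> A" "C \<subseteq> H + x" "subspace (H + x)"
    using H x assms set_plus_least[of A H x] set_plus_superset[of H x] subspace_set_plus by auto
  \<comment> \<open>\<open>H + x\<close> has larger dimension than the maximal proper subspace
    \<open>H\<close>, so it cannot be proper in \<open>A\<close>.\<close>
  then have "H + x = A" using max[of "H + x"] dim by auto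
  then show ?thesis using H dim by blast
qed

section \<open>Closure and cyclic core in a q-matroid\<close>

lemma q_matroidD:
  assumes "q_matroid r"
  shows "subspace A \<Longrightarrow> 0 \<le> r A" "subspace A \<Longrightarrow> r A \<le> int (dim A)"
    "subspace A \<Longrightarrow> subspace B \<Longrightarrow> A \<subseteq> B \<Longrightarrow> r A \<le> r B"
    "subspace A \<Longrightarrow> subspace B \<Longrightarrow> r (A + B) + r (A \<inter> B) \<le> r A + r B"
  using assms unfolding q_matroid_def by blast+

text \<open>This is monotonicity of the nullity. Adding a line raises the dimension by 1 and, by
  (R3) and (R1), the rank by at most 1, so a largest \<open>C\<close> between \<open>A\<close> and
  \<open>B\<close> satisfying the bound must be \<open>B\<close>.\<close>

lemma rank_diff_le_dim_diff:
  assumes r: "q_matroid r" and A: "subspace A" and B: "subspace B" and "A \<subseteq> B"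
  shows "r B - r A \<le> int (dim B) - int (dim A)"
proof -
  let ?P = "\<lambda>C. subspace C \<and> A \<subseteq> C \<and> C \<subseteq> B \<and> r C - r A \<le> int (dim C) - int (dim A)"
  have "?P A" using A \<open>A \<subseteq> B\<close> by simp
  then obtain C where C: "?P C" and max: "\<And>K. ?P K \<Longrightarrow> dim K \<le> dim C"
    using ex_max_dim[of ?P A] by metis
  have "B \<subseteq> C"
  proof (rule ccontr)
    assume "\<not> B \<subseteq> C"
    then obtain x where x: "subspace x" "dim x = 1" "x \<subseteq> B" "\<not> x \<subseteq> C"
      using ex_line[OF B, of C] C by auto
    have s: "subspace (C + x)" "C \<subseteq> C + x" "C + x \<subseteq> B"
      using C x B subspace_set_plus set_plus_superset(1)[of C x] set_plus_least[of B C x] by simp_all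
    have d: "dim (C + x) = dim C + 1" using dim_plus_line[of C x] C x by simp
    have "r (C + x) + r (C \<inter> x) \<le> r C + r x" using q_matroidD(4)[OF r] C x by simp
    moreover have "0 \<le> r (C \<inter> x)" "r x \<le> 1"
      using q_matroidD(1)[OF r subspace_inter[of C x]] q_matroidD(2)[OF r, of x] C x by simp_all
    ultimately have "?P (C + x)" using s d C by auto
    then show False using max[of "C + x"] d by simp
  qed
  then have "C = B" using C by (simp add: subset_antisym)
  then show ?thesis using C by simp
qed

text \<open>A subspace of largest dimension among those of rank \<open>r A\<close> above
  \<open>A\<close> is flat, since adding any line must change the rank.\<close>

lemma ex_closure:
  assumes r: "q_matroid r" and A: "subspace A"
  obtains F where "flat r F" "A \<subseteq> F" "r F = r A" "\<And>G. flat r G \<Longrightarrow> A \<subseteq> G \<Longrightarrow> F \<subseteq> G"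
proof -
  let ?P = "\<lambda>F. subspace F \<and> A \<subseteq> F \<and> r F = r A"
  obtain F where F: "?P F" and max: "\<And>K. ?P K \<Longrightarrow> dim K \<le> dim F"
    using ex_max_dim[of ?P A] A by blast
  have "r F < r (F + x)" if x: "subspace x" "dim x = 1" "\<not> x \<subseteq> F" for x
  proof -
    have s: "subspace (F + x)" "F \<subseteq> F + x" using F x subspace_set_plus set_plus_superset by auto
    have "dim (F + x) = dim F + 1" using dim_plus_line F x by blast
    then have "\<not> ?P (F + x)" using max[of "F + x"] by auto
    then have "r (F + x) \<noteq> r F" using s F by auto
    moreover have "r F \<le> r (F + x)" using q_matroidD(3)[OF r] s F by blast
    ultimately show ?thesis by simp
  qed
  then have flat: "flat r F" using F unfolding flat_def by blast
  have "F \<subseteq> G" if G: "flat r G" "A \<subseteq> G" for G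
  proof (rule ccontr)
    assume "\<not> ?thesis"
    have sG: "subspace G" using G flat_def by blast
    then obtain x where x: "subspace x" "dim x = 1" "x \<subseteq> F" "\<not> x \<subseteq> G"
      using ex_line[of F G] F \<open>\<not> F \<subseteq> G\<close> by blast
    have "r G < r (G + x)" using G x unfolding flat_def by blast
    have s: "subspace (A + x)" "A \<subseteq> A + x" "x \<subseteq> A + x" "A + x \<subseteq> F"
      using A F x subspace_set_plus set_plus_superset[of A x] set_plus_least[of F A x] by auto
    have sp: "subspace ((A + x) + G)" "subspace ((A + x) \<inter> G)" "subspace (G + x)"
      using s sG x subspace_set_plus subspace_inter by auto
    \<comment> \<open>\<open>A + x\<close> lies in \<open>F\<close> and so still has rank at most
      \<open>r A\<close>; submodularity of \<open>A + x\<close> and \<open>G\<close> then forbids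
      \<open>x\<close> to raise the rank of \<open>G\<close>, against flatness.\<close>
    have "G + x \<subseteq> (A + x) + G"
      using set_plus_least[OF sp(1), of G x] set_plus_superset[OF s(1) sG] s(3) by blast
    then have "r (G + x) \<le> r ((A + x) + G)" using q_matroidD(3)[OF r] sp by blast
    moreover have "r ((A + x) + G) + r ((A + x) \<inter> G) \<le> r (A + x) + r G"
      using q_matroidD(4)[OF r s(1) sG] .
    moreover have "r A \<le> r ((A + x) \<inter> G)" using q_matroidD(3)[OF r A sp(2)] s G by blast
    moreover have "r (A + x) \<le> r A" using q_matroidD(3)[OF r s(1), of F] F s by simp
    ultimately show False using \<open>r G < r (G + x)\<close> by linarith
  qed
  then show thesis using that F flat by blast
qed

text \<open>A hyperplane of \<open>C\<close> above \<open>A\<close> has the rank of \<open>C\<close>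
  but one dimension less, so the nullity already drops there, and it is monotone below.\<close>

lemma cyclic_nullity_less:
  assumes r: "q_matroid r" and C: "cyclic r C" and A: "subspace A" "A \<subset> C"
  shows "int (dim A) - r A < int (dim C) - r C"
proof -
  have "subspace C" using C cyclic_def by blast
  then obtain H where H: "subspace H" "A \<subseteq> H" "H \<subseteq> C" "dim C = dim H + 1"
    using ex_hyperplane A by blast
  then have "r H = r C" using C unfolding cyclic_def by blast
  then show ?thesis using rank_diff_le_dim_diff[OF r A(1) H(1,2)] H(4) by simp
qed

text \<open>Take \<open>C\<close> of smallest dimension with the nullity of \<open>A\<close>. The
  nullity drops on each hyperplane of \<open>C\<close>, which leaves no room for the rank to drop as
  well.\<close>

lemma ex_cyclic_core:
  assumes r: "q_matroid r" and A: "subspace A"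
  obtains C where "cyclic r C" "C \<subseteq> A" "int (dim C) - r C = int (dim A) - r A"
    "\<And>D. cyclic r D \<Longrightarrow> D \<subseteq> A \<Longrightarrow> D \<subseteq> C"
proof -
  let ?n = "\<lambda>A. int (dim A) - r A"
  let ?P = "\<lambda>C. subspace C \<and> C \<subseteq> A \<and> ?n C = ?n A"
  obtain C where C: "?P C" and min: "\<And>K. ?P K \<Longrightarrow> dim C \<le> dim K"
    using ex_min_dim[of ?P A] A by blast
  have mono: "?n X \<le> ?n Y" if "subspace X" "subspace Y" "X \<subseteq> Y" for X Y
    using rank_diff_le_dim_diff[OF r that] by simp
  have "r H = r C" if H: "subspace H" "H \<subseteq> C" "dim C = dim H + 1" for H
  proof -
    have "?n H \<noteq> ?n A" using min[of H] H C by auto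
    then have "?n H < ?n C" using mono[of H C] H C by simp
    then show ?thesis using q_matroidD(3)[OF r H(1) _ H(2)] C H(3) by simp
  qed
  then have cyc: "cyclic r C" using C unfolding cyclic_def by blast
  have "D \<subseteq> C" if D: "cyclic r D" "D \<subseteq> A" for D
  proof (rule ccontr)
    assume "\<not> ?thesis"
    have sD: "subspace D" using D cyclic_def by blast
    have s: "subspace (D \<inter> C)" "subspace (D + C)" "D + C \<subseteq> A"
      using sD C D subspace_inter subspace_set_plus set_plus_least[OF A, of D C] by auto
    \<comment> \<open>If \<open>D\<close> is not inside \<open>C\<close>, this strict drop and
      supermodularity of \<open>?n\<close> make the nullity of \<open>D + C\<close> exceed that of
      \<open>C\<close>, hence that of \<open>A\<close>, although
      \<open>D + C \<subseteq> A\<close>.\<close>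
    have "?n (D \<inter> C) < ?n D" using cyclic_nullity_less[OF r D(1) s(1)] \<open>\<not> D \<subseteq> C\<close> by blast
    moreover have "?n D + ?n C \<le> ?n (D + C) + ?n (D \<inter> C)"
      using dim_set_plus_Int[OF sD, of C] q_matroidD(4)[OF r sD, of C] C by simp
    moreover have "?n (D + C) \<le> ?n A" using mono s A by blast
    ultimately show False using C by linarith
  qed
  then show thesis using that cyc C by blast
qed

text \<open>The cyclic core of \<open>A + B\<close> contains both cyclic summands, so it is all of
  \<open>A + B\<close>.\<close>

lemma cyclic_set_plus:
  assumes r: "q_matroid r" and A: "cyclic r A" and B: "cyclic r B"
  shows "cyclic r (A + B)"
proof -
  have sA: "subspace A" and sB: "subspace B" using A B cyclic_def by auto
  obtain C where C: "cyclic r C" "C \<subseteq> A + B" "\<And>D. cyclic r D \<Longrightarrow> D \<subseteq> A + B \<Longrightarrow> D \<subseteq> C"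
    using ex_cyclic_core[OF r subspace_set_plus[OF sA sB]] by metis
  have "A \<subseteq> C" "B \<subseteq> C" using C(3) A B set_plus_superset[OF sA sB] by auto
  then have "A + B \<subseteq> C" using set_plus_least C(1) cyclic_def by blast
  then show ?thesis using C by (metis subset_antisym)
qed

text \<open>A hyperplane of \<open>F\<close> meets \<open>A\<close> in \<open>A\<close> itself or in
  a hyperplane of \<open>A\<close>; either way the intersection already has rank
  \<open>r A = r F\<close>. Thus closures of cyclic spaces are cyclic.\<close>

lemma cyclic_if_rank_eq:
  assumes r: "q_matroid r" and A: "cyclic r A" and F: "subspace F" "A \<subseteq> F" "r F = r A"
  shows "cyclic r F"
proof -
  have sA: "subspace A" using A cyclic_def by blast
  have "r H = r F" if H: "subspace H" "H \<subseteq> F" "dim F = dim H + 1" for H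
  proof -
    have s: "subspace (A \<inter> H)" using sA H subspace_inter by blast
    have "int (dim (A + H)) \<le> int (dim F)"
      using dim_subset set_plus_least[OF F(1,2) H(2)] by simp
    then have "int (dim A) - int (dim (A \<inter> H)) \<le> 1" using dim_set_plus_Int[OF sA H(1)] H(3) by simp
    then have "dim A = dim (A \<inter> H) + 1 \<or> A \<inter> H = A"
      using subspace_less_dim[OF s sA] by force
    then have "r (A \<inter> H) = r A" using A s unfolding cyclic_def by auto
    moreover have "r (A \<inter> H) \<le> r H" "r H \<le> r F"
      using q_matroidD(3)[OF r s H(1)] q_matroidD(3)[OF r H(1) F(1) H(2)] by simp_all
    ultimately show ?thesis using F by simp
  qed
  then show ?thesis using F unfolding cyclic_def by blast
qed

text \<open>The closure of \<open>F \<inter> G\<close> lies in every flat above it, in particular in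
  \<open>F\<close> and in \<open>G\<close>.\<close>

lemma flat_Int:
  assumes r: "q_matroid r" and F: "flat r F" and G: "flat r G"
  shows "flat r (F \<inter> G)"
proof -
  have sF: "subspace F" and sG: "subspace G" using F G flat_def by auto
  then have s: "subspace (F \<inter> G)" using subspace_inter by blast
  obtain H where H: "flat r H" "F \<inter> G \<subseteq> H" "\<And>K. flat r K \<Longrightarrow> F \<inter> G \<subseteq> K \<Longrightarrow> H \<subseteq> K"
    using ex_closure[OF r s] by metis
  have "H \<subseteq> F" "H \<subseteq> G" using H(3) F G by auto
  then have "H = F \<inter> G" using H(2) by blast
  then show ?thesis using H by simp
qed

text \<open>A line inside \<open>F\<close> must raise the rank of \<open>C\<close>, since the
  nullity of \<open>C\<close> is already that of \<open>F\<close>. For a line outside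
  \<open>F\<close>, submodularity carries the strict increase from \<open>F\<close> down to
  \<open>C\<close>. Thus the cyclic core of a flat is flat.\<close>

lemma flat_if_nullity_eq:
  assumes r: "q_matroid r" and F: "flat r F" and C: "subspace C" "C \<subseteq> F"
    and eq: "int (dim C) - r C = int (dim F) - r F"
  shows "flat r C"
proof -
  have sF: "subspace F" using F flat_def by blast
  have "r C < r (C + x)" if x: "subspace x" "dim x = 1" "\<not> x \<subseteq> C" for x
  proof (cases "x \<subseteq> F")
    case True
    have s: "subspace (C + x)" "C + x \<subseteq> F"
      using C x True sF subspace_set_plus set_plus_least[of F C x] by auto
    have "dim (C + x) = dim C + 1" using dim_plus_line C x by blast
    then show ?thesis using rank_diff_le_dim_diff[OF r s(1) sF s(2)] eq by simp
  next
    case False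
    then have less: "r F < r (F + x)" using F x unfolding flat_def by blast
    have s: "subspace (C + x)" "C \<subseteq> C + x" "x \<subseteq> C + x"
      using C x subspace_set_plus set_plus_superset[of C x] by auto
    have s': "subspace ((C + x) + F)" "subspace (F + x)" "subspace ((C + x) \<inter> F)"
      using s sF x subspace_set_plus subspace_inter by auto
    have "F + x \<subseteq> (C + x) + F"
      using set_plus_least[OF s'(1), of F x] set_plus_superset[OF s(1) sF] s(3) by blast
    then have "r (F + x) \<le> r ((C + x) + F)" using q_matroidD(3)[OF r] s' by blast
    moreover have "r ((C + x) + F) + r ((C + x) \<inter> F) \<le> r (C + x) + r F"
      using q_matroidD(4)[OF r s(1) sF] .
    moreover have "r C \<le> r ((C + x) \<inter> F)" using q_matroidD(3)[OF r C(1) s'(3)] s C by blast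
    ultimately show ?thesis using less by linarith
  qed
  then show ?thesis using C unfolding flat_def by blast
qed

section \<open>The lattice of cyclic flats and the necessity of (Z1) to (Z3)\<close>

lemma cyclic_flat_join:
  assumes r: "q_matroid r" and F: "cyclic_flat r F" and G: "cyclic_flat r G"
  obtains J where "cyclic_flat r J" "F \<subseteq> J" "G \<subseteq> J" "r J = r (F + G)"
    "\<And>K. cyclic_flat r K \<Longrightarrow> F \<subseteq> K \<Longrightarrow> G \<subseteq> K \<Longrightarrow> J \<subseteq> K"
proof -
  have s: "subspace F" "subspace G" using F G unfolding cyclic_flat_def flat_def by auto
  obtain J where J: "flat r J" "F + G \<subseteq> J" "r J = r (F + G)"
    "\<And>K. flat r K \<Longrightarrow> F + G \<subseteq> K \<Longrightarrow> J \<subseteq> K"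
    using ex_closure[OF r subspace_set_plus[OF s]] by metis
  have "cyclic r J"
  proof (rule cyclic_if_rank_eq[OF r _ _ J(2,3)])
    show "cyclic r (F + G)" using cyclic_set_plus[OF r] F G unfolding cyclic_flat_def by simp
    show "subspace J" using J(1) unfolding flat_def by simp
  qed
  moreover have "J \<subseteq> K" if "cyclic_flat r K" "F \<subseteq> K" "G \<subseteq> K" for K
    using that J(4)[of K] set_plus_least[of K F G] unfolding cyclic_flat_def flat_def by simp
  moreover have "F \<subseteq> J" "G \<subseteq> J" using set_plus_superset[OF s] J(2) by simp_all
  ultimately show thesis using that[of J] J(1,3) unfolding cyclic_flat_def by simp
qed

lemma cyclic_flat_meet:
  assumes r: "q_matroid r" and F: "cyclic_flat r F" and G: "cyclic_flat r G"
  obtains M where "cyclic_flat r M" "M \<subseteq> F" "M \<subseteq> G"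
    "int (dim M) - r M = int (dim (F \<inter> G)) - r (F \<inter> G)"
    "\<And>K. cyclic_flat r K \<Longrightarrow> K \<subseteq> F \<Longrightarrow> K \<subseteq> G \<Longrightarrow> K \<subseteq> M"
proof -
  have fl: "flat r (F \<inter> G)" using flat_Int[OF r] F G unfolding cyclic_flat_def by blast
  then have s: "subspace (F \<inter> G)" using flat_def by blast
  obtain M where M: "cyclic r M" "M \<subseteq> F \<inter> G" "int (dim M) - r M = int (dim (F \<inter> G)) - r (F \<inter> G)"
    "\<And>K. cyclic r K \<Longrightarrow> K \<subseteq> F \<inter> G \<Longrightarrow> K \<subseteq> M"
    using ex_cyclic_core[OF r s] by metis
  have "flat r M" using flat_if_nullity_eq[OF r fl _ M(2,3)] M(1) unfolding cyclic_def by simp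
  then show thesis using that[of M] M unfolding cyclic_flat_def by simp
qed

lemma cyclic_flat_bottom:
  assumes r: "q_matroid r"
  obtains F where "cyclic_flat r F" "r F = 0" "\<And>K. cyclic_flat r K \<Longrightarrow> F \<subseteq> K"
proof -
  have s: "subspace {0}" by simp
  obtain F where F: "flat r F" "{0} \<subseteq> F" "r F = r {0}"
    "\<And>K. flat r K \<Longrightarrow> {0} \<subseteq> K \<Longrightarrow> F \<subseteq> K"
    using ex_closure[OF r s] by metis
  \<comment> \<open>The zero space has no hyperplanes, so it is vacuously cyclic; its closure is the
    least cyclic flat.\<close>
  have "cyclic r {0}" unfolding cyclic_def by simp
  then have "cyclic r F" using cyclic_if_rank_eq[OF r] F flat_def by blast
  moreover have "r {0} = 0" using q_matroidD(1,2)[OF r s] by simp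
  moreover have "F \<subseteq> K" if "cyclic_flat r K" for K
    using F(4)[of K] that subspace_0 unfolding cyclic_flat_def flat_def by blast
  ultimately show thesis using that F unfolding cyclic_flat_def by simp
qed

lemma cyclic_flats_axioms:
  fixes r :: "'b set \<Rightarrow> int"
  assumes r: "q_matroid r"
  defines "Z \<equiv> {F. cyclic_flat r F}"
  shows "Z \<noteq> {}" and "lattice (incl_order Z)" and "\<bottom>\<^bsub>incl_order Z\<^esub> \<in> Z" and "r \<bottom>\<^bsub>incl_order Z\<^esub> = 0"
    and "\<lbrakk>F \<in> Z; G \<in> Z; G \<subset> F\<rbrakk> \<Longrightarrow> 0 < r F - r G \<and> r F - r G < int (dim F) - int (dim G)"
    and "\<lbrakk>F \<in> Z; G \<in> Z\<rbrakk> \<Longrightarrow> r F + r G \<ge> r (F \<squnion>\<^bsub>incl_order Z\<^esub> G) + r (F \<sqinter>\<^bsub>incl_order Z\<^esub> G)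
          + int (quotient_dim (F \<inter> G) (F \<sqinter>\<^bsub>incl_order Z\<^esub> G))"
proof -
  obtain B where B: "cyclic_flat r B" "r B = 0" "\<And>K. cyclic_flat r K \<Longrightarrow> B \<subseteq> K"
    using cyclic_flat_bottom[OF r] by metis
  then have bot: "\<bottom>\<^bsub>incl_order Z\<^esub> = B" by (intro bottom_incl_order_eq) (auto simp: Z_def)
  then show "Z \<noteq> {}" "\<bottom>\<^bsub>incl_order Z\<^esub> \<in> Z" "r \<bottom>\<^bsub>incl_order Z\<^esub> = 0" using B Z_def by auto
  show "lattice (incl_order Z)"
  proof (rule lattice_incl_orderI)
    fix F G assume "F \<in> Z" "G \<in> Z"
    then have FG: "cyclic_flat r F" "cyclic_flat r G" by (auto simp: Z_def)
    show "\<exists>J\<in>Z. F \<subseteq> J \<and> G \<subseteq> J \<and> (\<forall>K\<in>Z. F \<subseteq> K \<longrightarrow> G \<subseteq> K \<longrightarrow> J \<subseteq> K)"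
      by (rule cyclic_flat_join[OF r FG]) (auto simp: Z_def)
    show "\<exists>M\<in>Z. M \<subseteq> F \<and> M \<subseteq> G \<and> (\<forall>K\<in>Z. K \<subseteq> F \<longrightarrow> K \<subseteq> G \<longrightarrow> K \<subseteq> M)"
      by (rule cyclic_flat_meet[OF r FG]) (auto simp: Z_def)
  qed
  { assume *: "F \<in> Z" "G \<in> Z" "G \<subset> F"
    then have cf: "cyclic_flat r F" "cyclic_flat r G" by (auto simp: Z_def)
    then have s: "subspace F" "subspace G" unfolding cyclic_flat_def flat_def by auto
    have "\<not> F \<subseteq> G" using * by blast
    then obtain x where x: "subspace x" "dim x = 1" "x \<subseteq> F" "\<not> x \<subseteq> G" using ex_line s by blast
    \<comment> \<open>Flatness of \<open>G\<close> yields the lower bound in (Z2), cyclicity of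
      \<open>F\<close> the upper one.\<close>
    then have "r G < r (G + x)" using cf unfolding cyclic_flat_def flat_def by blast
    moreover have "G + x \<subseteq> F" using set_plus_least s x * by blast
    then have "r (G + x) \<le> r F" using q_matroidD(3)[OF r] s x subspace_set_plus by blast
    moreover have "int (dim G) - r G < int (dim F) - r F"
      using cyclic_nullity_less[OF r] cf s * unfolding cyclic_flat_def by blast
    ultimately show "0 < r F - r G \<and> r F - r G < int (dim F) - int (dim G)" by linarith }
  { assume *: "F \<in> Z" "G \<in> Z"
    then have cf: "cyclic_flat r F" "cyclic_flat r G" by (auto simp: Z_def)
    then have s: "subspace F" "subspace G" unfolding cyclic_flat_def flat_def by auto
    obtain J where J: "cyclic_flat r J" "F \<subseteq> J" "G \<subseteq> J" "r J = r (F + G)"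
      "\<And>K. cyclic_flat r K \<Longrightarrow> F \<subseteq> K \<Longrightarrow> G \<subseteq> K \<Longrightarrow> J \<subseteq> K"
      using cyclic_flat_join[OF r cf] by metis
    obtain M where M: "cyclic_flat r M" "M \<subseteq> F" "M \<subseteq> G"
      "int (dim M) - r M = int (dim (F \<inter> G)) - r (F \<inter> G)"
      "\<And>K. cyclic_flat r K \<Longrightarrow> K \<subseteq> F \<Longrightarrow> K \<subseteq> G \<Longrightarrow> K \<subseteq> M"
      using cyclic_flat_meet[OF r cf] by metis
    have "J \<in> Z" "M \<in> Z" using J(1) M(1) by (simp_all add: Z_def)
    then have eqs: "F \<squnion>\<^bsub>incl_order Z\<^esub> G = J" "F \<sqinter>\<^bsub>incl_order Z\<^esub> G = M"
      using join_incl_order_eq[OF * _ J(2,3)] meet_incl_order_eq[OF * _ M(2,3)] J(5) M(5)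
      by (simp_all add: Z_def)
    have "subspace M" using M(1) unfolding cyclic_flat_def flat_def by blast
    then have "quotient_dim (F \<inter> G) M + dim M = dim (F \<inter> G)"
      using quotient_dim_eq[OF subspace_inter[OF s], of M] M(2,3) by simp
    then show "r F + r G \<ge> r (F \<squnion>\<^bsub>incl_order Z\<^esub> G) + r (F \<sqinter>\<^bsub>incl_order Z\<^esub> G)
          + int (quotient_dim (F \<inter> G) (F \<sqinter>\<^bsub>incl_order Z\<^esub> G))"
      unfolding eqs using q_matroidD(4)[OF r s] J(4) M(4) by linarith }
qed

section \<open>Construction of a q-matroid from \<open>Z\<close>, and the equivalence\<close>

text \<open>Bottom is a choice that says nothing until a least element is known to exist. A member
  of minimal dimension is one: its meet with any \<open>K\<close> cannot be smaller.\<close>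

lemma bottom_incl_order_mem:
  assumes "Z \<noteq> {}" "lattice (incl_order Z)" and sub: "\<And>F. F \<in> Z \<Longrightarrow> subspace F"
  shows "\<bottom>\<^bsub>incl_order Z\<^esub> \<in> Z"
proof -
  obtain M where M: "M \<in> Z" and min: "\<And>K. K \<in> Z \<Longrightarrow> dim M \<le> dim K"
    using ex_min_dim[of "\<lambda>F. F \<in> Z"] assms(1) by blast
  have "M \<subseteq> K" if K: "K \<in> Z" for K
  proof -
    note D = lattice_incl_orderD[OF assms(2) M K]
    have "M \<sqinter>\<^bsub>incl_order Z\<^esub> K = M"
      using subspace_dim_equal[OF sub[OF D(4)] sub[OF M] D(5) min[OF D(4)]] .
    then show ?thesis using D(6) by simp
  qed
  then show ?thesis using bottom_incl_order_eq[of M Z] M by simp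
qed

text \<open>(Z3) is phrased with some upper bound \<open>J\<close> and lower bound \<open>M\<close>
  in \<open>Z\<close>, and the quotient dimension as a difference; both uses consume it in this
  form.\<close>

lemma ex_q_matroid_cyclic_flats:
  fixes r :: "'b set \<Rightarrow> int"
  assumes r: "q_matroid r"
    and sub: "\<And>F. F \<in> Z \<Longrightarrow> subspace F"
    and Z1: "N \<in> Z" "r N = 0"
    and Z2: "\<And>F G. F \<in> Z \<Longrightarrow> G \<in> Z \<Longrightarrow> G \<subset> F \<Longrightarrow> 0 < r F - r G \<and> r F - r G < int (dim F) - int (dim G)"
    and Z3: "\<And>F G. F \<in> Z \<Longrightarrow> G \<in> Z \<Longrightarrow> \<exists>J\<in>Z. \<exists>M\<in>Z. F \<subseteq> J \<and> G \<subseteq> J \<and> M \<subseteq> F \<and> M \<subseteq> G \<and>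
      r F + r G \<ge> r J + r M + int (dim (F \<inter> G)) - int (dim M)"
  shows "\<exists>r'. q_matroid r' \<and> {F. cyclic_flat r' F} = Z \<and> (\<forall>F\<in>Z. r' F = r F)"
proof -
  \<comment> \<open>In any q-matroid taking the values \<open>r F\<close> on \<open>Z\<close>,
    \<open>w F A\<close> bounds the rank of \<open>A\<close>: \<open>A \<inter> F\<close> has rank
    at most \<open>r F\<close>, and the remaining dimensions of \<open>A\<close> add at most 1
    each.\<close>
  define w where "w F A = r F + int (dim A) - int (dim (A \<inter> F))" for F A
  have w_nonneg: "0 \<le> w F A" if "F \<in> Z" for F A
    using q_matroidD(1)[OF r sub[OF that]] dim_subset[of "A \<inter> F" A] unfolding w_def by simp
  \<comment> \<open>The minimum is attained whatever the size of \<open>Z\<close>, because the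
    values are nonnegative integers; for the same reason \<open>nat\<close> loses nothing.\<close>
  have "\<exists>F. F \<in> Z \<and> (\<forall>G. G \<in> Z \<longrightarrow> w F A \<le> w G A)" for A
    using ex_has_least_nat[of "\<lambda>F. F \<in> Z" N "\<lambda>F. nat (w F A)"] Z1 w_nonneg by (simp add: nat_le_iff)
  then obtain m where m: "\<And>A. m A \<in> Z" "\<And>A G. G \<in> Z \<Longrightarrow> w (m A) A \<le> w G A" by metis
  define r' where "r' A = w (m A) A" for A
  have r'_le: "r' A \<le> w G A" if "G \<in> Z" for G A using m that unfolding r'_def by blast
  \<comment> \<open>This fact and the next are the two halves of (Z2): along strict inclusions in
    \<open>Z\<close> nullity and rank both grow strictly.\<close>
  have nullity: "r F - int (dim F) \<le> r M - int (dim M) \<and> (M \<noteq> F \<longrightarrow> r F - int (dim F) < r M - int (dim M))"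
    if "F \<in> Z" "M \<in> Z" "M \<subseteq> F" for F M using Z2[OF that(1,2)] that(3) by (cases "M = F") (simp_all add: psubset_eq)
  have rank: "r F \<le> r J \<and> (J \<noteq> F \<longrightarrow> r F < r J)"
    if "F \<in> Z" "J \<in> Z" "F \<subseteq> J" for F J using Z2[OF that(2,1)] that(3) by (cases "J = F") (simp_all add: psubset_eq)
  text \<open>The strict inequalities are what makes \<open>F\<close> a flat, respectively cyclic, for \<open>r'\<close>.\<close>
  have w_Z: "r F \<le> w G F \<and> (\<not> G \<subseteq> F \<longrightarrow> r F < w G F) \<and> (\<not> F \<subseteq> G \<longrightarrow> r F < w G F)"
    if FG: "F \<in> Z" "G \<in> Z" for F G
  proof -
    obtain J M where JM: "J \<in> Z" "M \<in> Z" "F \<subseteq> J" "G \<subseteq> J" "M \<subseteq> F" "M \<subseteq> G"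
      "r F + r G \<ge> r J + r M + int (dim (F \<inter> G)) - int (dim M)"
      using Z3[OF FG] by blast
    \<comment> \<open>(Z3) gives \<open>w G F \<ge> r J + (r M - dim M) - (r F - dim F)\<close>. The
      nullity comparison makes this at least \<open>r J\<close>, and \<open>r J \<ge> r F\<close>;
      the first is strict if \<open>M \<noteq> F\<close>, the second if
      \<open>J \<noteq> F\<close>.\<close>
    note * = nullity[OF FG(1) JM(2,5)] rank[OF FG(1) JM(1,3)]
    show ?thesis
    proof (intro conjI impI)
      show "r F \<le> w G F" using * JM(7) unfolding w_def by linarith
      assume "\<not> G \<subseteq> F"
      then have "J \<noteq> F" using JM by blast
      then show "r F < w G F" using * JM(7) unfolding w_def by linarith
    next
      assume "\<not> F \<subseteq> G"
      then have "M \<noteq> F" using JM by blast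
      then show "r F < w G F" using * JM(7) unfolding w_def by linarith
    qed
  qed
  have r'_Z: "r' F = r F" if "F \<in> Z" for F
    using r'_le[OF that, of F] w_Z[OF that m(1), of F] unfolding r'_def w_def by simp
  have w_mono: "w F A \<le> w F B" if "F \<in> Z" "subspace A" "subspace B" "A \<subseteq> B" for F A B
  proof -
    \<comment> \<open>From \<open>A\<close> to \<open>B\<close> the intersection with
      \<open>F\<close> grows by \<open>dim (A + (B \<inter> F)) - dim A\<close>, hence by no more
      than the dimension itself.\<close>
    have "A + (B \<inter> F) \<subseteq> B" using set_plus_least that by blast
    then have "dim (A + (B \<inter> F)) \<le> dim B" using dim_subset by blast
    moreover have "A \<inter> (B \<inter> F) = A \<inter> F" using that by blast
    ultimately show ?thesis
      using dim_set_plus_Int[OF that(2) subspace_inter[OF that(3) sub[OF that(1)]]] unfolding w_def by simp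
  qed
  have r'_mono: "r' A \<le> r' B" if "subspace A" "subspace B" "A \<subseteq> B" for A B
    using r'_le[OF m(1), of A B] w_mono[OF m(1) that, of B] unfolding r'_def by simp
  have r'_submod: "r' (A + B) + r' (A \<inter> B) \<le> r' A + r' B" if sA: "subspace A" and sB: "subspace B" for A B
  proof -
    define F where "F = m A"
    define G where "G = m B"
    have FG: "F \<in> Z" "G \<in> Z" using m F_def G_def by auto
    obtain J M where JM: "J \<in> Z" "M \<in> Z" "F \<subseteq> J" "G \<subseteq> J" "M \<subseteq> F" "M \<subseteq> G"
      "r F + r G \<ge> r J + r M + int (dim (F \<inter> G)) - int (dim M)"
      using Z3[OF FG] by blast
    have s: "subspace F" "subspace G" "subspace J" "subspace M" using sub FG JM by auto
    \<comment> \<open>With \<open>F\<close> and \<open>G\<close> optimal for \<open>A\<close> and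
      \<open>B\<close>, test \<open>J\<close> on the sum and \<open>M\<close> on the intersection.
      The two dimension inequalities that follow, each the modular identity with an inclusion,
      absorb the term \<open>dim (F \<inter> G) - dim M\<close> of (Z3).\<close>
    have "r' (A + B) + r' (A \<inter> B) \<le> w J (A + B) + w M (A \<inter> B)" using r'_le JM by (simp add: add_mono)
    moreover have "int (dim (A + B)) + int (dim (A \<inter> B)) = int (dim A) + int (dim B)"
      using dim_set_plus_Int sA sB .
    moreover have "int (dim (A \<inter> F)) + int (dim (B \<inter> G)) \<le>
        int (dim ((A + B) \<inter> J)) + int (dim ((A \<inter> B) \<inter> (F \<inter> G)))"
    proof -
      have "(A \<inter> F) + (B \<inter> G) \<subseteq> (A + B) \<inter> J"
        using set_plus_mono2[of "A \<inter> F" A "B \<inter> G" B] set_plus_least[OF s(3), of "A \<inter> F" "B \<inter> G"] JM(3,4)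
        by (simp add: le_infI2)
      then have "dim ((A \<inter> F) + (B \<inter> G)) \<le> dim ((A + B) \<inter> J)" using dim_subset by blast
      moreover have "(A \<inter> F) \<inter> (B \<inter> G) = (A \<inter> B) \<inter> (F \<inter> G)" by blast
      ultimately show ?thesis
        using dim_set_plus_Int[OF subspace_inter[OF sA s(1)] subspace_inter[OF sB s(2)]] by simp
    qed
    moreover have "int (dim ((A \<inter> B) \<inter> (F \<inter> G))) + int (dim M) \<le> int (dim (F \<inter> G)) + int (dim ((A \<inter> B) \<inter> M))"
    proof -
      have "((A \<inter> B) \<inter> (F \<inter> G)) + M \<subseteq> F \<inter> G"
        using set_plus_least[OF subspace_inter[OF s(1,2)] Int_lower2 Int_greatest[OF JM(5,6)]] .
      then have "dim (((A \<inter> B) \<inter> (F \<inter> G)) + M) \<le> dim (F \<inter> G)" using dim_subset by blast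
      moreover have "((A \<inter> B) \<inter> (F \<inter> G)) \<inter> M = (A \<inter> B) \<inter> M" using JM by blast
      ultimately show ?thesis
        using dim_set_plus_Int[OF subspace_inter[OF subspace_inter[OF sA sB] subspace_inter[OF s(1,2)]] s(4)]
        by simp
    qed
    ultimately show ?thesis using JM(7) unfolding r'_def w_def F_def[symmetric] G_def[symmetric] by linarith
  qed
  \<comment> \<open>(Z1) enters here: the member \<open>N\<close> of rank 0 gives
    \<open>w N A \<le> dim A\<close>.\<close>
  have "r' A \<le> int (dim A)" for A using r'_le[OF Z1(1), of A] Z1(2) unfolding w_def by linarith
  moreover have "0 \<le> r' A" for A using w_nonneg m(1) unfolding r'_def .
  ultimately have q: "q_matroid r'" unfolding q_matroid_def using r'_mono r'_submod by blast
  have flatZ: "flat r' F" if F: "F \<in> Z" for F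
  proof -
    have "r' F < r' (F + x)" if x: "subspace x" "dim x = 1" "\<not> x \<subseteq> F" for x
    proof -
      define G where "G = m (F + x)"
      have G: "G \<in> Z" using m G_def by blast
      have s: "subspace F" "subspace G" "subspace (F + x)" using sub F G x subspace_set_plus by auto
      have d: "dim (F + x) = dim F + 1" using dim_plus_line s x by blast
      have *: "int (dim ((F + x) \<inter> G)) \<le> int (dim (F \<inter> G)) + 1"
      proof -
        have "F + ((F + x) \<inter> G) \<subseteq> F + x"
          using set_plus_least[OF s(3)] set_plus_superset[OF s(1) x(1)] by blast
        then have "dim (F + ((F + x) \<inter> G)) \<le> dim F + 1" using dim_subset d by metis
        moreover have "F \<inter> ((F + x) \<inter> G) = F \<inter> G" using set_plus_superset[OF s(1) x(1)] by blast
        ultimately show ?thesis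
          using dim_set_plus_Int[OF s(1) subspace_inter[OF s(3,2)]] by simp
      qed
      \<comment> \<open>If \<open>G \<subseteq> F\<close>, the intersection with \<open>G\<close>
        does not grow and \<open>w G\<close> gains a full 1. Otherwise \<open>w G F\<close> already
        exceeds \<open>r F\<close>, and by \<open>*\<close> the value does not fall.\<close>
      have "r F < w G (F + x)"
      proof (cases "G \<subseteq> F")
        case True
        then have "(F + x) \<inter> G = G" "F \<inter> G = G" using set_plus_superset[OF s(1) x(1)] by auto
        then show ?thesis using w_Z[OF F G] d unfolding w_def by simp
      next
        case False
        then show ?thesis using w_Z[OF F G] * d unfolding w_def by simp
      qed
      then show ?thesis using r'_Z[OF F] unfolding r'_def G_def by simp
    qed
    then show ?thesis using sub F unfolding flat_def by blast
  qed
  have cycZ: "cyclic r' F" if F: "F \<in> Z" for F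
  proof -
    have "r' H = r' F" if H: "subspace H" "H \<subseteq> F" "dim F = dim H + 1" for H
    proof -
      define G where "G = m H"
      have G: "G \<in> Z" using m G_def by blast
      \<comment> \<open>If \<open>F \<subseteq> G\<close>, then \<open>w G H = r G\<close>.
        Otherwise \<open>w G\<close> falls by at most 1 from \<open>F\<close> to \<open>H\<close>,
        and the strict integer inequality \<open>r F < w G F\<close> pays for it.\<close>
      have "r F \<le> w G H"
      proof (cases "F \<subseteq> G")
        case True
        then have "H \<inter> G = H" using H by blast
        then show ?thesis using rank[OF F G True] unfolding w_def by simp
      next
        case False
        have "dim (H \<inter> G) \<le> dim (F \<inter> G)" using dim_subset H by (meson Int_mono order_refl)
        then show ?thesis using w_Z[OF F G] False H(3) unfolding w_def by simp
      qed
      then have "r' F \<le> r' H" using r'_Z[OF F] unfolding r'_def G_def by simp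
      then show ?thesis using r'_mono[OF H(1) sub[OF F] H(2)] by simp
    qed
    then show ?thesis using sub F unfolding cyclic_def by blast
  qed
  have "A \<in> Z" if A: "cyclic_flat r' A" for A
  proof -
    define F where "F = m A"
    have F: "F \<in> Z" "r' A = w F A" using m unfolding F_def r'_def by auto
    have sA: "subspace A" using A unfolding cyclic_flat_def flat_def by blast
    have AF: "A \<subseteq> F"
    proof (rule ccontr)
      assume "\<not> ?thesis"
      \<comment> \<open>A hyperplane containing \<open>A \<inter> F\<close> has the same
        intersection with \<open>F\<close>, so \<open>w F\<close> falls by 1 on it, against
        cyclicity of \<open>A\<close>.\<close>
      then obtain H where H: "subspace H" "A \<inter> F \<subseteq> H" "H \<subseteq> A" "dim A = dim H + 1"
        using ex_hyperplane[of "A \<inter> F" A] subspace_inter sA sub F by blast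
      then have "H \<inter> F = A \<inter> F" by blast
      then have "r' H < r' A" using r'_le[OF F(1), of H] F(2) H(4) unfolding w_def by simp
      then show False using A H unfolding cyclic_flat_def cyclic_def by auto
    qed
    \<comment> \<open>As \<open>A \<subseteq> F\<close>, the value \<open>w F A\<close> is just
      \<open>r F\<close>; a line of \<open>F\<close> outside the flat \<open>A\<close> would push
      the rank above \<open>r' F\<close>.\<close>
    have "F \<subseteq> A"
    proof (rule ccontr)
      assume "\<not> ?thesis"
      then obtain x where x: "subspace x" "dim x = 1" "x \<subseteq> F" "\<not> x \<subseteq> A"
        using ex_line sub F sA by blast
      then have "r' A < r' (A + x)" using A unfolding cyclic_flat_def flat_def by blast
      also have "\<dots> \<le> r' F"
        using r'_mono[OF subspace_set_plus[OF sA x(1)] sub[OF F(1)]]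
          set_plus_least[OF sub[OF F(1)] AF x(3)] by simp
      also have "r' F = r F" using r'_Z F by blast
      finally show False using F(2) AF unfolding w_def by (simp add: Int_absorb2)
    qed
    then have "A = F" using AF by blast
    then show ?thesis using F by simp
  qed
  then have "{F. cyclic_flat r' F} = Z" using flatZ cycZ unfolding cyclic_flat_def by blast
  then show ?thesis using q r'_Z by blast
qed

text \<open>\<open>Z \<noteq> {}\<close> is spelled out because the empty carrier satisfies
  \<open>lattice\<close>, whereas speaking of a least element presupposes a member.\<close>

lemma cyclic_flats_iff:
  fixes r :: "'b set \<Rightarrow> int"
  assumes r: "q_matroid r" and sub: "\<And>F. F \<in> Z \<Longrightarrow> subspace F"
  shows "(\<exists>r'. q_matroid r' \<and> {F. cyclic_flat r' F} = Z \<and> (\<forall>F\<in>Z. r' F = r F)) \<longleftrightarrow>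
    (Z \<noteq> {} \<and> lattice (incl_order Z) \<and> r \<bottom>\<^bsub>incl_order Z\<^esub> = 0 \<and>
     (\<forall>F\<in>Z. \<forall>G\<in>Z. G \<subset> F \<longrightarrow> 0 < r F - r G \<and> r F - r G < int (dim F) - int (dim G)) \<and>
     (\<forall>F\<in>Z. \<forall>G\<in>Z. r F + r G \<ge> r (F \<squnion>\<^bsub>incl_order Z\<^esub> G) + r (F \<sqinter>\<^bsub>incl_order Z\<^esub> G)
          + int (quotient_dim (F \<inter> G) (F \<sqinter>\<^bsub>incl_order Z\<^esub> G))))" (is "?L \<longleftrightarrow> ?R")
proof
  assume ?L
  then obtain r' where r': "q_matroid r'" and Z: "{F. cyclic_flat r' F} = Z" and eq: "\<And>F. F \<in> Z \<Longrightarrow> r' F = r F"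
    by blast
  note ax = cyclic_flats_axioms[OF r', unfolded Z]
  have "r F + r G \<ge> r (F \<squnion>\<^bsub>incl_order Z\<^esub> G) + r (F \<sqinter>\<^bsub>incl_order Z\<^esub> G)
          + int (quotient_dim (F \<inter> G) (F \<sqinter>\<^bsub>incl_order Z\<^esub> G))" if "F \<in> Z" "G \<in> Z" for F G
    \<comment> \<open>Join and meet are members of \<open>Z\<close>, so \<open>r'\<close> and
      \<open>r\<close> agree on all four terms.\<close>
    using ax(6)[OF that] eq that lattice_incl_orderD[OF ax(2) that] by simp
  moreover have "0 < r F - r G \<and> r F - r G < int (dim F) - int (dim G)" if "F \<in> Z" "G \<in> Z" "G \<subset> F" for F G
    using ax(5)[OF that] eq that by simp
  ultimately show ?R using ax(1-4) eq by simp
next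
  assume R: ?R
  then have lat: "lattice (incl_order Z)" by blast
  show ?L
  proof (rule ex_q_matroid_cyclic_flats[OF r sub])
    show "\<bottom>\<^bsub>incl_order Z\<^esub> \<in> Z" using bottom_incl_order_mem R sub by blast
    show "r \<bottom>\<^bsub>incl_order Z\<^esub> = 0" using R by blast
    show "0 < r F - r G \<and> r F - r G < int (dim F) - int (dim G)" if "F \<in> Z" "G \<in> Z" "G \<subset> F" for F G
      using R that by blast
    fix F G assume FG: "F \<in> Z" "G \<in> Z"
    note D = lattice_incl_orderD[OF lat FG]
    have "r F + r G \<ge> r (F \<squnion>\<^bsub>incl_order Z\<^esub> G) + r (F \<sqinter>\<^bsub>incl_order Z\<^esub> G)
          + int (quotient_dim (F \<inter> G) (F \<sqinter>\<^bsub>incl_order Z\<^esub> G))" using R FG by blast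
    moreover have "quotient_dim (F \<inter> G) (F \<sqinter>\<^bsub>incl_order Z\<^esub> G) + dim (F \<sqinter>\<^bsub>incl_order Z\<^esub> G) = dim (F \<inter> G)"
      using quotient_dim_eq sub FG D subspace_inter by (metis Int_greatest)
    ultimately have "r F + r G \<ge> r (F \<squnion>\<^bsub>incl_order Z\<^esub> G) + r (F \<sqinter>\<^bsub>incl_order Z\<^esub> G)
        + int (dim (F \<inter> G)) - int (dim (F \<sqinter>\<^bsub>incl_order Z\<^esub> G))" by linarith
    then show "\<exists>J\<in>Z. \<exists>M\<in>Z. F \<subseteq> J \<and> G \<subseteq> J \<and> M \<subseteq> F \<and> M \<subseteq> G \<and>
      r F + r G \<ge> r J + r M + int (dim (F \<inter> G)) - int (dim M)" using D by blast
  qed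
qed

end

theorem theorem3p5:
  fixes scale :: "'k::{field,finite} \<Rightarrow> 'v::ab_group_add \<Rightarrow> 'v"
    and Basis :: "'v set"
    and r :: "'v set \<Rightarrow> int"
    and Z :: "'v set set"
  assumes "finite_dimensional_vector_space scale Basis"
    and "vector_space.q_matroid scale r"
    and "\<And>F. F \<in> Z \<Longrightarrow> module.subspace scale F"
  shows "(\<exists>r'. vector_space.q_matroid scale r' \<and>
              {F. vector_space.cyclic_flat scale r' F} = Z \<and>
              (\<forall>F\<in>Z. r' F = r F))
    \<longleftrightarrow>
    (Z \<noteq> {} \<and> lattice (incl_order Z) \<and>
     r \<bottom>\<^bsub>incl_order Z\<^esub> = 0 \<and>
     (\<forall>F\<in>Z. \<forall>G\<in>Z. G \<subset> F \<longrightarrow>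
        0 < r F - r G \<and>
        r F - r G < int (vector_space.dim scale F) - int (vector_space.dim scale G)) \<and>
     (\<forall>F\<in>Z. \<forall>G\<in>Z.
        r F + r G \<ge> r (F \<squnion>\<^bsub>incl_order Z\<^esub> G) + r (F \<sqinter>\<^bsub>incl_order Z\<^esub> G)
          + int (vector_space.quotient_dim scale (F \<inter> G) (F \<sqinter>\<^bsub>incl_order Z\<^esub> G))))"
  using finite_dimensional_vector_space.cyclic_flats_iff[OF assms] by blast

end
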